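(* Let $\Gamma_n=\{P_1,\ldots,P_k\}$ with $k\ge3$, let $Q$ be a witness of $\Gamma_n$, and let $v_0,v_1,\ldots,v_r$ be a special path in $G_n(Q)$ of minimal length among all special paths in $G_n(Q)$; after reindexing, $v_0\cong P_1$, $v_1,\ldots,v_{r-1}\cong P_2$, $v_r\cong P_3$. Write $A=v_0$, $C=v_r$ (the anchor copies). Suppose the path contains at least two copies of $P_2$ (i.e. $r\ge 3$). Then (1) $\bigcup_{j=0}^r v_j=A\cup C$, and (2) the number of copies of $P_2$ on the path, $r-1$, equals $|A\setminus(A\cap C)|-1=|C\setminus(A\cap C)|-1$.
   Context: $\Gamma_n$ is a set of $k$ pairwise non-isomorphic posets of size $n$; $Q$ is a witness if the set of isomorphism classes of downsets of $Q$ of size $n$ is exactly $\Gamma_n$. The exchange graph $G_n(Q)$ has as vertices all downsets of $Q$ of size $n$ (as subsets), with an edge between two such downsets when they differ by exactly one element. A special path is a path $v_0,v_1,\ldots,v_r$ in $G_n(Q)$ with $r\ge 2$ such that for some three distinct indices $a,b,c$, $v_0\cong P_a$, $v_1,\ldots,v_{r-1}\cong P_b$, and $v_r\cong P_c$. *)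

theory Defs
  imports Main
begin

definition downset :: "'a set \<Rightarrow> 'a rel \<Rightarrow> 'a set \<Rightarrow> bool" where
  "downset S R D \<longleftrightarrow> D \<subseteq> S \<and> (\<forall>x\<in>D. \<forall>y. (y, x) \<in> R \<longrightarrow> y \<in> D)"

definition poset_iso :: "'a set \<Rightarrow> 'a rel \<Rightarrow> 'b set \<Rightarrow> 'b rel \<Rightarrow> bool" where
  "poset_iso D R P Rp \<longleftrightarrow> (\<exists>f. bij_betw f D P \<and>
      (\<forall>x\<in>D. \<forall>y\<in>D. (x, y) \<in> R \<longleftrightarrow> (f x, f y) \<in> Rp))"

definition Gamma :: "nat \<Rightarrow> nat \<Rightarrow> (nat \<Rightarrow> 'b set) \<Rightarrow> (nat \<Rightarrow> 'b rel) \<Rightarrow> bool" where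
  "Gamma n k Pc Pr \<longleftrightarrow>
     (\<forall>i\<in>{1..k}. partial_order_on (Pc i) (Pr i) \<and> finite (Pc i) \<and> card (Pc i) = n) \<and>
     (\<forall>i\<in>{1..k}. \<forall>j\<in>{1..k}. i \<noteq> j \<longrightarrow> \<not> poset_iso (Pc i) (Pr i) (Pc j) (Pr j))"

definition witness :: "'a set \<Rightarrow> 'a rel \<Rightarrow> nat \<Rightarrow> nat \<Rightarrow> (nat \<Rightarrow> 'b set) \<Rightarrow> (nat \<Rightarrow> 'b rel) \<Rightarrow> bool" where
  "witness S R n k Pc Pr \<longleftrightarrow>
     finite S \<and> partial_order_on S R \<and>
     (\<forall>D. downset S R D \<and> card D = n \<longrightarrow> (\<exists>i\<in>{1..k}. poset_iso D R (Pc i) (Pr i))) \<and>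
     (\<forall>i\<in>{1..k}. \<exists>D. downset S R D \<and> card D = n \<and> poset_iso D R (Pc i) (Pr i))"

definition exch_vertex :: "'a set \<Rightarrow> 'a rel \<Rightarrow> nat \<Rightarrow> 'a set \<Rightarrow> bool" where
  "exch_vertex S R n D \<longleftrightarrow> downset S R D \<and> finite D \<and> card D = n"

definition exch_edge :: "'a set \<Rightarrow> 'a set \<Rightarrow> bool" where
  "exch_edge D D' \<longleftrightarrow> card (D - D') = 1 \<and> card (D' - D) = 1"

definition exch_path :: "'a set \<Rightarrow> 'a rel \<Rightarrow> nat \<Rightarrow> (nat \<Rightarrow> 'a set) \<Rightarrow> nat \<Rightarrow> bool" where
  "exch_path S R n v r \<longleftrightarrow>
     (\<forall>j\<le>r. exch_vertex S R n (v j)) \<and> inj_on v {0..r} \<and>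
     (\<forall>j<r. exch_edge (v j) (v (Suc j)))"

definition special_path_idx ::
  "'a set \<Rightarrow> 'a rel \<Rightarrow> nat \<Rightarrow> nat \<Rightarrow> (nat \<Rightarrow> 'b set) \<Rightarrow> (nat \<Rightarrow> 'b rel)
    \<Rightarrow> (nat \<Rightarrow> 'a set) \<Rightarrow> nat \<Rightarrow> nat \<Rightarrow> nat \<Rightarrow> nat \<Rightarrow> bool" where
  "special_path_idx S R n k Pc Pr v r a b c \<longleftrightarrow>
     exch_path S R n v r \<and> r \<ge> 2 \<and>
     a \<in> {1..k} \<and> b \<in> {1..k} \<and> c \<in> {1..k} \<and> a \<noteq> b \<and> a \<noteq> c \<and> b \<noteq> c \<and>
     poset_iso (v 0) R (Pc a) (Pr a) \<and>
     (\<forall>j\<in>{1..r-1}. poset_iso (v j) R (Pc b) (Pr b)) \<and>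
     poset_iso (v r) R (Pc c) (Pr c)"

definition special_path ::
  "'a set \<Rightarrow> 'a rel \<Rightarrow> nat \<Rightarrow> nat \<Rightarrow> (nat \<Rightarrow> 'b set) \<Rightarrow> (nat \<Rightarrow> 'b rel)
    \<Rightarrow> (nat \<Rightarrow> 'a set) \<Rightarrow> nat \<Rightarrow> bool" where
  "special_path S R n k Pc Pr v r \<longleftrightarrow> (\<exists>a b c. special_path_idx S R n k Pc Pr v r a b c)"

end

theory Submission
  imports Defs
begin

(* Colour each vertex of G_n(Q) by the isomorphism class of its downset. A walk whose end colours
   differ and which meets a third colour contains a segment that shortcuts to a special path no
   longer than the walk. Two vertices A, C are joined by a walk A = g_0, ..., g_d = C with
   d = |A - C|, obtained by repeatedly trading a maximal element of A - C for a minimal element of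
   C - A. Depending on the colour of g_1, one of the walks v_1 g_0 g_1, or g_1 ... g_d v_(r-1), or
   g itself meets three colours, so some special path has length at most max 2 d; minimality and
   r >= 3 force r = d. Since |v_j - C| drops by at most one per step, it must drop at every step of
   the path, so every element added along the path lies in C and all v_j lie in A u C. *)

definition walk :: "('v \<Rightarrow> bool) \<Rightarrow> ('v \<Rightarrow> 'v \<Rightarrow> bool) \<Rightarrow> (nat \<Rightarrow> 'v) \<Rightarrow> nat \<Rightarrow> bool" where
  "walk V E w m \<longleftrightarrow> (\<forall>j\<le>m. V (w j)) \<and> (\<forall>j<m. E (w j) (w (Suc j)))"

lemma walk_vertex: "walk V E w m \<Longrightarrow> j \<le> m \<Longrightarrow> V (w j)"
  unfolding walk_def by blast

lemma walk_edge: "walk V E w m \<Longrightarrow> j < m \<Longrightarrow> E (w j) (w (Suc j))"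
  unfolding walk_def by blast

lemma walk_mono: "walk V E w m \<Longrightarrow> (\<And>x. V x \<Longrightarrow> V' x) \<Longrightarrow> walk V' E w m"
  unfolding walk_def by blast

lemma walk_segment: "walk V E w m \<Longrightarrow> s + L \<le> m \<Longrightarrow> walk V E (\<lambda>t. w (s + t)) L"
  unfolding walk_def by auto

lemma walk_Cons:
  assumes "V x" "E x (w 0)" "walk V E w m"
  shows "walk V E (\<lambda>t. if t = 0 then x else w (t - 1)) (Suc m)"
  unfolding walk_def
proof (intro conjI allI impI)
  fix j assume "j \<le> Suc m"
  then show "V (if j = 0 then x else w (j - 1))"
    using assms walk_vertex by (cases j) auto
next
  fix j assume "j < Suc m"
  then show "E (if j = 0 then x else w (j - 1)) (if Suc j = 0 then x else w (Suc j - 1))"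
    using assms walk_edge by (cases j) auto
qed

lemma walk_snoc:
  "walk V E w m \<Longrightarrow> E (w m) x \<Longrightarrow> V x \<Longrightarrow> walk V E (w(Suc m := x)) (Suc m)"
  unfolding walk_def by (auto simp: less_Suc_eq le_Suc_eq)

(* Cut out the closed subwalk between two visits of one vertex. The end vertices are visited only
   once, so both visits are interior and the length stays at least 2. *)
lemma walk_shortcut:
  assumes "walk V E u L" "2 \<le> L" "u 0 \<notin> u ` {0<..L}" "u L \<notin> u ` {0<..<L}"
  shows "\<exists>p L'. walk V E p L' \<and> inj_on p {0..L'} \<and> 2 \<le> L' \<and> L' \<le> L \<and>
           p 0 = u 0 \<and> p L' = u L \<and> p ` {0<..<L'} \<subseteq> u ` {0<..<L}"
  using assms
proof (induction L arbitrary: u rule: less_induct)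
  case (less L)
  show ?case
  proof (cases "inj_on u {0..L}")
    case True
    then show ?thesis using less.prems by blast
  next
    case False
    then obtain x y where xy: "x < y" "y \<le> L" "u x = u y"
      unfolding inj_on_def by (metis atLeastAtMost_iff linorder_neqE_nat)
    have "0 < x"
    proof (rule ccontr)
      assume "\<not> 0 < x"
      then have "u 0 = u y" "y \<in> {0<..L}" using xy by auto
      then show False using less.prems(3) by blast
    qed
    have "y < L"
    proof (rule ccontr)
      assume "\<not> y < L"
      then have "u L = u x" "x \<in> {0<..<L}" using xy \<open>0 < x\<close> by auto
      then show False using less.prems(4) by blast
    qed
    define L' where "L' = L - (y - x)"
    define u' where "u' t = (if t \<le> x then u t else u (t + (y - x)))" for t
    have "x < L'" "L' < L"
      using xy \<open>0 < x\<close> \<open>y < L\<close> unfolding L'_def by auto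
    have walk': "walk V E u' L'"
      unfolding walk_def
    proof (intro conjI allI impI)
      fix j assume "j \<le> L'"
      then show "V (u' j)"
        unfolding u'_def L'_def using walk_vertex[OF less.prems(1)] xy by auto
    next
      fix j assume "j < L'"
      then show "E (u' j) (u' (Suc j))"
        unfolding u'_def L'_def using walk_edge[OF less.prems(1)] xy
        by (cases "j < x") (auto simp: not_less le_Suc_eq)
    qed
    have interior: "u' ` {0<..L'} \<subseteq> u ` {0<..L}" "u' ` {0<..<L'} \<subseteq> u ` {0<..<L}"
      unfolding u'_def L'_def using xy \<open>y < L\<close> by (auto intro!: imageI)
    have ends: "u' 0 = u 0" "u' L' = u L"
      unfolding u'_def L'_def using xy \<open>y < L\<close> by auto
    have "u' 0 \<notin> u' ` {0<..L'}" "u' L' \<notin> u' ` {0<..<L'}"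
      using interior ends less.prems(3,4) by auto
    moreover have "2 \<le> L'"
      using \<open>0 < x\<close> \<open>x < L'\<close> by simp
    ultimately obtain p L'' where "walk V E p L''" "inj_on p {0..L''}" "2 \<le> L''" "L'' \<le> L'"
        "p 0 = u' 0" "p L'' = u' L'" "p ` {0<..<L''} \<subseteq> u' ` {0<..<L'}"
      using less.IH[OF \<open>L' < L\<close> walk'] by blast
    with \<open>L' < L\<close> interior(2) ends show ?thesis
      by (intro exI[of _ p] exI[of _ L'']) auto
  qed
qed

lemma monochromatic_run:
  fixes c :: "nat \<Rightarrow> 'c"
  assumes "l \<le> p" "p \<le> m" "c p \<noteq> c l" "c p \<noteq> c m"
  shows "\<exists>i j. l \<le> i \<and> i < p \<and> p < j \<and> j \<le> m \<and> c i \<noteq> c p \<and> c j \<noteq> c p \<and>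
           (\<forall>t\<in>{i<..<j}. c t = c p)"
proof -
  define I where "I = {t. l \<le> t \<and> t < p \<and> c t \<noteq> c p}"
  define J where "J = {t. p < t \<and> t \<le> m \<and> c t \<noteq> c p}"
  define i j where "i = Max I" and "j = Min J"
  have "l \<in> I" "m \<in> J"
    using assms unfolding I_def J_def by (auto simp: order.order_iff_strict)
  moreover have "finite I" "finite J"
    unfolding I_def J_def by auto
  ultimately have i: "i \<in> I" "\<And>t. t \<in> I \<Longrightarrow> t \<le> i" and j: "j \<in> J" "\<And>t. t \<in> J \<Longrightarrow> j \<le> t"
    unfolding i_def j_def by (auto intro: Max_in Min_in)
  have "c t = c p" if "i < t" "t < j" for t
  proof (rule ccontr)
    assume "c t \<noteq> c p"
    moreover from this have "t \<noteq> p"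
      by blast
    ultimately have "t \<in> I \<or> t \<in> J"
      using that i(1) j(1) unfolding I_def J_def by (auto simp: nat_neq_iff)
    then show False
      using that i(2) j(2) by (meson leD)
  qed
  moreover have "l \<le> i" "i < p" "c i \<noteq> c p" "p < j" "j \<le> m" "c j \<noteq> c p"
    using i(1) j(1) unfolding I_def J_def by auto
  ultimately show ?thesis
    by (meson greaterThanLessThan_iff)
qed

definition special_segment :: "(nat \<Rightarrow> 'c) \<Rightarrow> nat \<Rightarrow> nat \<Rightarrow> bool" where
  "special_segment c i j \<longleftrightarrow>
     Suc i < j \<and> c i \<noteq> c j \<and> (\<exists>b. b \<noteq> c i \<and> b \<noteq> c j \<and> (\<forall>t\<in>{i<..<j}. c t = b))"

lemma special_segment_shift:
  assumes "special_segment c i j"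
  shows "special_segment (\<lambda>t. c (i + t)) 0 (j - i)"
proof -
  obtain b where "Suc i < j" "c i \<noteq> c j" "b \<noteq> c i" "b \<noteq> c j" "\<forall>t\<in>{i<..<j}. c t = b"
    using assms unfolding special_segment_def by blast
  moreover have "i + t \<in> {i<..<j}" if "t \<in> {0<..<j - i}" for t
    using that by auto
  ultimately show ?thesis
    unfolding special_segment_def by auto
qed

(* Take the maximal run of the colour c p around p. If its two neighbours have the same colour x,
   recurse on the part from l to just after the left neighbour when x differs from c l, and
   otherwise on the part from just before the right neighbour to m. *)
lemma three_colours_special_segment:
  fixes c :: "nat \<Rightarrow> 'c"
  assumes "l \<le> p" "p \<le> m" "c l \<noteq> c m" "c p \<noteq> c l" "c p \<noteq> c m"
  shows "\<exists>i j. l \<le> i \<and> j \<le> m \<and> special_segment c i j"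
  using assms
proof (induction "m - l" arbitrary: l p m rule: less_induct)
  case less
  obtain i j where run: "l \<le> i" "i < p" "p < j" "j \<le> m" "c i \<noteq> c p" "c j \<noteq> c p"
    and inside: "\<forall>t\<in>{i<..<j}. c t = c p"
    using monochromatic_run[OF less.prems(1,2,4,5)] by blast
  have "Suc i \<in> {i<..<j}" "j - 1 \<in> {i<..<j}"
    using run by auto
  then have Suc_i: "c (Suc i) = c p" and pred_j: "c (j - 1) = c p"
    using inside by blast+
  consider "c i \<noteq> c j" | "c i = c j" "c i \<noteq> c l" | "c j = c i" "c j \<noteq> c m"
    using less.prems(3) by metis
  then show ?case
  proof cases
    case 1
    have "Suc i < j" "c p \<noteq> c i" "c p \<noteq> c j"
      using run by auto
    with 1 inside have "special_segment c i j"
      unfolding special_segment_def by blast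
    with run show ?thesis by blast
  next
    case 2
    have "\<exists>i' j'. l \<le> i' \<and> j' \<le> Suc i \<and> special_segment c i' j'"
      using run 2 Suc_i less.prems by (intro less.hyps[of "Suc i" l i]) auto
    moreover have "Suc i \<le> m"
      using run by simp
    ultimately show ?thesis by (meson le_trans)
  next
    case 3
    have "l < p"
      using less.prems le_neq_implies_less by blast
    have "\<exists>i' j'. j - 1 \<le> i' \<and> j' \<le> m \<and> special_segment c i' j'"
      using run 3 pred_j less.prems \<open>l < p\<close> by (intro less.hyps[of m "j - 1" j]) auto
    moreover have "l \<le> j - 1"
      using run \<open>l < p\<close> by simp
    ultimately show ?thesis by (meson le_trans)
  qed
qed

definition coloured_special_path ::
  "('v \<Rightarrow> bool) \<Rightarrow> ('v \<Rightarrow> 'v \<Rightarrow> bool) \<Rightarrow> ('v \<Rightarrow> 'c) \<Rightarrow> (nat \<Rightarrow> 'v) \<Rightarrow> nat \<Rightarrow> bool" where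
  "coloured_special_path V E col u L \<longleftrightarrow>
     walk V E u L \<and> inj_on u {0..L} \<and> special_segment (col \<circ> u) 0 L"

lemma coloured_special_pathE:
  assumes "coloured_special_path V E col v r"
  obtains b where "walk V E v r" "inj_on v {0..r}" "2 \<le> r" "col (v 0) \<noteq> col (v r)"
    "b \<noteq> col (v 0)" "b \<noteq> col (v r)" "\<And>t. 0 < t \<Longrightarrow> t < r \<Longrightarrow> col (v t) = b"
  using assms unfolding coloured_special_path_def special_segment_def by auto

lemma walk_special_segment_shortcut:
  assumes "walk V E u L" "special_segment (col \<circ> u) 0 L"
  shows "\<exists>q L'. L' \<le> L \<and> coloured_special_path V E col q L'"
proof -
  obtain b where seg: "2 \<le> L" "col (u 0) \<noteq> col (u L)" "b \<noteq> col (u 0)" "b \<noteq> col (u L)"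
    and interior: "\<forall>t\<in>{0<..<L}. col (u t) = b"
    using assms(2) unfolding special_segment_def by auto
  have "col (u t) \<noteq> col (u 0)" if "t \<in> {0<..L}" for t
    using that interior seg by (cases "t = L") auto
  moreover have "col (u t) \<noteq> col (u L)" if "t \<in> {0<..<L}" for t
    using that interior seg by auto
  ultimately have "u 0 \<notin> u ` {0<..L}" "u L \<notin> u ` {0<..<L}"
    by (metis imageE)+
  then obtain q L' where q: "walk V E q L'" "inj_on q {0..L'}" "2 \<le> L'" "L' \<le> L"
    "q 0 = u 0" "q L' = u L" "q ` {0<..<L'} \<subseteq> u ` {0<..<L}"
    using walk_shortcut[OF assms(1) seg(1)] by blast
  have "col (q t) = b" if "t \<in> {0<..<L'}" for t
  proof -
    have "q t \<in> u ` {0<..<L}"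
      using q(7) that by blast
    then show ?thesis
      using interior by auto
  qed
  then have "special_segment (col \<circ> q) 0 L'"
    unfolding special_segment_def using q(3,5,6) seg by auto
  then show ?thesis
    unfolding coloured_special_path_def using q by blast
qed

lemma walk_three_colours_special:
  assumes "walk V E w m" "p \<le> m" "col (w 0) \<noteq> col (w m)"
    and "col (w p) \<noteq> col (w 0)" "col (w p) \<noteq> col (w m)"
  shows "\<exists>u L. L \<le> m \<and> coloured_special_path V E col u L"
proof -
  obtain i j where "j \<le> m" "special_segment (col \<circ> w) i j"
    using three_colours_special_segment[of 0 p m "col \<circ> w"] assms(2-) by auto
  moreover from this have "walk V E (\<lambda>t. w (i + t)) (j - i)"
    using walk_segment[OF assms(1)] unfolding special_segment_def by simp
  moreover have "special_segment (col \<circ> (\<lambda>t. w (i + t))) 0 (j - i)"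
    using special_segment_shift[OF \<open>special_segment (col \<circ> w) i j\<close>] by (simp add: comp_def)
  ultimately show ?thesis
    using walk_special_segment_shortcut by (metis diff_le_self le_trans)
qed

lemma coloured_special_path_start_neighbour:
  assumes "coloured_special_path V E col v r" "V x" "E (v 0) x" "col x = col (v r)"
    and sym: "\<And>x y. E x y \<Longrightarrow> E y x"
  shows "\<exists>u L. L \<le> 2 \<and> coloured_special_path V E col u L"
proof -
  obtain b where v: "walk V E v r" "2 \<le> r" "col (v 0) \<noteq> col (v r)" "b \<noteq> col (v 0)" "b \<noteq> col (v r)"
    "col (v 1) = b"
    using assms(1) by (elim coloured_special_pathE) auto
  have "walk V E (\<lambda>t. if t = 0 then v 1 else if t = 1 then v 0 else x) 2"
    using walk_vertex[OF v(1)] walk_edge[OF v(1), of 0] v(2) assms(2,3) sym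
    unfolding walk_def numeral_2_eq_2 by (auto simp: less_Suc_eq le_Suc_eq)
  then show ?thesis
    by (rule walk_three_colours_special[of _ _ _ _ 1]) (use assms(4) v(3-6) in auto)
qed

lemma coloured_special_path_walk_to_end:
  assumes "coloured_special_path V E col v r" "walk V E h m" "h m = v r" "col (h 0) = col (v 0)"
    and sym: "\<And>x y. E x y \<Longrightarrow> E y x"
  shows "\<exists>u L. L \<le> Suc m \<and> coloured_special_path V E col u L"
proof -
  obtain b where v: "walk V E v r" "2 \<le> r" "col (v 0) \<noteq> col (v r)" "b \<noteq> col (v 0)" "b \<noteq> col (v r)"
    "col (v (r - 1)) = b"
    using assms(1) by (elim coloured_special_pathE) auto
  have "E (v r) (v (r - 1))" "V (v (r - 1))"
    using walk_edge[OF v(1), of "r - 1"] walk_vertex[OF v(1), of "r - 1"] sym v(2) by auto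
  then have "walk V E (h(Suc m := v (r - 1))) (Suc m)"
    using walk_snoc[OF assms(2)] assms(3) by simp
  then show ?thesis
    by (rule walk_three_colours_special[of _ _ _ _ m]) (use assms(3,4) v(3-6) in auto)
qed

lemma coloured_special_path_detour:
  assumes path: "coloured_special_path V E col v r"
    and g: "walk V E g d" "g 0 = v 0" "g d = v r"
    and sym: "\<And>x y. E x y \<Longrightarrow> E y x"
  shows "\<exists>u L. L \<le> max 2 d \<and> coloured_special_path V E col u L"
proof -
  have v: "inj_on v {0..r}" "2 \<le> r" "col (v 0) \<noteq> col (v r)"
    using path by (auto elim: coloured_special_pathE)
  have "d \<noteq> 0"
  proof
    assume "d = 0"
    then have "v 0 = v r"
      using g(2,3) by simp
    then show False
      using inj_onD[OF v(1)] v(2) by fastforce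
  qed
  consider "col (g 1) = col (v r)" | "col (g 1) = col (v 0)"
    | "col (g 1) \<noteq> col (v 0)" "col (g 1) \<noteq> col (v r)"
    by blast
  then show ?thesis
  proof cases
    case 1
    have "\<exists>u L. L \<le> 2 \<and> coloured_special_path V E col u L"
      using coloured_special_path_start_neighbour[OF path _ _ 1 sym] walk_vertex[OF g(1), of 1]
        walk_edge[OF g(1), of 0] g(2) \<open>d \<noteq> 0\<close> by simp
    then show ?thesis
      by (metis le_max_iff_disj)
  next
    case 2
    have "\<exists>u L. L \<le> Suc (d - 1) \<and> coloured_special_path V E col u L"
      using coloured_special_path_walk_to_end[OF path walk_segment[OF g(1), of 1 "d - 1"] _ _ sym]
        2 g(3) \<open>d \<noteq> 0\<close> by simp
    then show ?thesis
      using \<open>d \<noteq> 0\<close> by (metis Suc_pred' le_max_iff_disj not_gr0)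
  next
    case 3
    have "\<exists>u L. L \<le> d \<and> coloured_special_path V E col u L"
      by (rule walk_three_colours_special[OF g(1), of 1]) (use 3 v(3) g(2,3) \<open>d \<noteq> 0\<close> in auto)
    then show ?thesis
      by (metis le_max_iff_disj)
  qed
qed

lemma finite_partial_order_extremal:
  assumes "trans R" "antisym R" "finite A" "A \<noteq> {}"
  shows finite_partial_order_minimal: "\<exists>m\<in>A. \<forall>x\<in>A. (x, m) \<in> R \<longrightarrow> x = m"
    and finite_partial_order_maximal: "\<exists>m\<in>A. \<forall>x\<in>A. (m, x) \<in> R \<longrightarrow> x = m"
proof -
  define less where "less x y \<longleftrightarrow> (x, y) \<in> R \<and> x \<noteq> y" for x y
  have asym: "asymp_on A less"
    using assms(2) unfolding less_def by (auto intro: asymp_onI dest: antisymD)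
  have trans: "transp_on A less"
    using assms(1,2) unfolding less_def by (auto intro!: transp_onI dest: transD antisymD)
  show "\<exists>m\<in>A. \<forall>x\<in>A. (x, m) \<in> R \<longrightarrow> x = m"
    using Finite_Set.bex_min_element[OF assms(3) asym trans assms(4)] unfolding less_def by blast
  show "\<exists>m\<in>A. \<forall>x\<in>A. (m, x) \<in> R \<longrightarrow> x = m"
    using Finite_Set.bex_max_element[OF assms(3) asym trans assms(4)] unfolding less_def by blast
qed

lemma downset_exchange:
  assumes "downset S R A" "downset S R C"
    and "x \<in> A - C" "\<forall>y\<in>A - C. (x, y) \<in> R \<longrightarrow> y = x"
    and "c \<in> C - A" "\<forall>y\<in>C - A. (y, c) \<in> R \<longrightarrow> y = c"
  shows "downset S R (insert c (A - {x}))"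
  unfolding downset_def
proof (intro conjI ballI allI impI)
  show "insert c (A - {x}) \<subseteq> S"
    using assms(1,2,5) unfolding downset_def by blast
next
  fix z y assume z: "z \<in> insert c (A - {x})" and "(y, z) \<in> R"
  show "y \<in> insert c (A - {x})"
  proof (cases "z = c")
    case True
    then have "y \<in> C"
      using assms(2,5) \<open>(y, z) \<in> R\<close> unfolding downset_def by blast
    then show ?thesis
      using assms(3,6) True \<open>(y, z) \<in> R\<close> by blast
  next
    case False
    then have "z \<in> A" "z \<noteq> x"
      using z by auto
    then have "y \<in> A"
      using assms(1) \<open>(y, z) \<in> R\<close> unfolding downset_def by blast
    moreover have "y \<noteq> x"
      using assms(2-4) \<open>z \<in> A\<close> \<open>z \<noteq> x\<close> \<open>(y, z) \<in> R\<close> unfolding downset_def by blast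
    ultimately show ?thesis
      by blast
  qed
qed

lemma exch_path_walk:
  "exch_path S R n v r \<longleftrightarrow> walk (exch_vertex S R n) exch_edge v r \<and> inj_on v {0..r}"
  unfolding exch_path_def walk_def by blast

lemma exch_edge_exchange:
  assumes "x \<in> A" "c \<notin> A"
  shows "exch_edge A (insert c (A - {x}))"
proof -
  have "A - insert c (A - {x}) = {x}" "insert c (A - {x}) - A = {c}"
    using assms by auto
  then show ?thesis
    unfolding exch_edge_def by simp
qed

lemma exch_edge_sym: "exch_edge D D' \<Longrightarrow> exch_edge D' D"
  unfolding exch_edge_def by simp

lemma exch_vertex_step:
  assumes "trans R" "antisym R" "exch_vertex S R n A" "exch_vertex S R n C" "card (A - C) = Suc d"
  shows "\<exists>A'. exch_vertex S R n A' \<and> exch_edge A A' \<and> card (A' - C) = d"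
proof -
  have fin: "finite A" "finite C" "card A = card C"
    using assms(3,4) unfolding exch_vertex_def by auto
  then have "card (C - A) = card (A - C)"
    by (simp add: card_Diff_subset_Int Int_commute)
  then have "A - C \<noteq> {}" "C - A \<noteq> {}"
    using assms(5) by (metis card.empty nat.distinct(1))+
  then obtain x c where x: "x \<in> A - C" "\<forall>y\<in>A - C. (x, y) \<in> R \<longrightarrow> y = x"
    and c: "c \<in> C - A" "\<forall>y\<in>C - A. (y, c) \<in> R \<longrightarrow> y = c"
    using finite_partial_order_maximal[OF assms(1,2), of "A - C"]
      finite_partial_order_minimal[OF assms(1,2), of "C - A"] fin by auto
  define A' where "A' = insert c (A - {x})"
  have "card A' = card A"
    unfolding A'_def using x c fin
    by (metis DiffD1 DiffE card_Suc_Diff1 card_insert_disjoint finite_Diff)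
  then have "exch_vertex S R n A'"
    using assms(3,4) downset_exchange[OF _ _ x c] fin
    unfolding exch_vertex_def A'_def by auto
  moreover have "exch_edge A A'"
    unfolding A'_def using exch_edge_exchange[of x A c] x c by simp
  moreover have "A' - C = (A - C) - {x}"
    unfolding A'_def using c by blast
  then have "card (A' - C) = d"
    using assms(5) x(1) fin by simp
  ultimately show ?thesis
    by blast
qed

lemma exch_vertex_walk:
  assumes "trans R" "antisym R" "exch_vertex S R n A" "exch_vertex S R n C"
  shows "\<exists>g. walk (exch_vertex S R n) exch_edge g (card (A - C)) \<and> g 0 = A \<and> g (card (A - C)) = C"
  using assms(3,4)
proof (induction "card (A - C)" arbitrary: A)
  case 0
  then have "A = C"
    unfolding exch_vertex_def by (metis Diff_eq_empty_iff card_0_eq card_subset_eq finite_Diff)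
  then show ?case
    using "0.prems" by (intro exI[of _ "\<lambda>_. A"]) (simp add: walk_def)
next
  case (Suc d)
  obtain A' where A': "exch_vertex S R n A'" "exch_edge A A'" "card (A' - C) = d"
    using exch_vertex_step[OF assms(1,2) Suc.prems] Suc.hyps(2) by metis
  then obtain g where g: "walk (exch_vertex S R n) exch_edge g d" "g 0 = A'" "g d = C"
    using Suc.hyps(1) Suc.prems(2) by metis
  have "walk (exch_vertex S R n) exch_edge (\<lambda>t. if t = 0 then A else g (t - 1)) (Suc d)"
    using walk_Cons[OF Suc.prems(1) _ g(1)] A'(2) g(2) by simp
  then show ?case
    using g(3) unfolding Suc.hyps(2)[symmetric] by auto
qed

lemma exch_edge_card_Diff_le:
  assumes "exch_edge D D'" "finite D'"
  shows "card (D - C) \<le> Suc (card (D' - C))"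
proof -
  obtain x where "D - D' = {x}"
    using assms(1) unfolding exch_edge_def by (meson card_1_singletonE)
  then have "D - C \<subseteq> insert x (D' - C)"
    by blast
  then have "card (D - C) \<le> card (insert x (D' - C))"
    using assms(2) by (intro card_mono) auto
  also have "\<dots> \<le> Suc (card (D' - C))"
    using assms(2) by (simp add: card_insert_if)
  finally show ?thesis .
qed

lemma exch_edge_card_Diff_mono:
  assumes "exch_edge D D'" "finite D'" "y \<in> D' - D" "y \<notin> C"
  shows "card (D - C) \<le> card (D' - C)"
proof -
  obtain x where "D - D' = {x}"
    using assms(1) unfolding exch_edge_def by (meson card_1_singletonE)
  then have "D - C \<subseteq> insert x (D' - C - {y})"
    using assms(3) by blast
  then have "card (D - C) \<le> card (insert x (D' - C - {y}))"
    using assms(2) by (intro card_mono) auto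
  also have "\<dots> \<le> Suc (card (D' - C - {y}))"
    using assms(2) by (simp add: card_insert_if)
  also have "\<dots> = card (D' - C)"
    using assms(2-4) card_Suc_Diff1[of "D' - C" y] by simp
  finally show ?thesis .
qed

lemma walk_card_Diff_le:
  assumes "walk finite exch_edge w m" "i \<le> j" "j \<le> m"
  shows "card (w i - C) \<le> (j - i) + card (w j - C)"
  using assms(2,3)
proof (induction j rule: dec_induct)
  case base
  then show ?case by simp
next
  case (step k)
  have "card (w k - C) \<le> Suc (card (w (Suc k) - C))"
    using exch_edge_card_Diff_le walk_edge[OF assms(1), of k] walk_vertex[OF assms(1), of "Suc k"] step
    by simp
  then show ?case
    using step by simp
qed

lemma geodesic_walk_subset_Un:
  assumes "walk finite exch_edge w m" "card (w 0 - w m) = m" "j \<le> m"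
  shows "w j \<subseteq> w 0 \<union> w m"
  using assms(3)
proof (induction j)
  case 0
  then show ?case by simp
next
  case (Suc j)
  have "y \<in> w m" if "y \<in> w (Suc j) - w j" for y
  proof (rule ccontr)
    assume "y \<notin> w m"
    then have "card (w j - w m) \<le> card (w (Suc j) - w m)"
      using exch_edge_card_Diff_mono[OF walk_edge[OF assms(1), of j] walk_vertex[OF assms(1), of "Suc j"]]
        Suc.prems that by simp
    moreover have "card (w 0 - w m) \<le> j + card (w j - w m)"
      using walk_card_Diff_le[OF assms(1), of 0 j "w m"] Suc.prems by simp
    moreover have "card (w (Suc j) - w m) \<le> (m - Suc j) + card (w m - w m)"
      using walk_card_Diff_le[OF assms(1), of "Suc j" m "w m"] Suc.prems by simp
    ultimately show False
      using assms(2) Suc.prems by simp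
  qed
  then show ?case
    using Suc by auto
qed

lemma poset_iso_sym:
  assumes "poset_iso D R P Rp"
  shows "poset_iso P Rp D R"
proof -
  obtain f where f: "bij_betw f D P" "\<forall>x\<in>D. \<forall>y\<in>D. (x, y) \<in> R \<longleftrightarrow> (f x, f y) \<in> Rp"
    using assms unfolding poset_iso_def by blast
  have "bij_betw (inv_into D f) P D"
    using f(1) by (rule bij_betw_inv_into)
  moreover have "inv_into D f p \<in> D" "f (inv_into D f p) = p" if "p \<in> P" for p
    using f(1) that by (auto simp: bij_betw_def inv_into_into f_inv_into_f)
  then have "\<forall>p\<in>P. \<forall>q\<in>P. (p, q) \<in> Rp \<longleftrightarrow> (inv_into D f p, inv_into D f q) \<in> R"
    using f(2) by metis
  ultimately show ?thesis
    unfolding poset_iso_def by blast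
qed

lemma poset_iso_trans:
  assumes "poset_iso A RA B RB" "poset_iso B RB C RC"
  shows "poset_iso A RA C RC"
proof -
  obtain f where f: "bij_betw f A B" "\<forall>x\<in>A. \<forall>y\<in>A. (x, y) \<in> RA \<longleftrightarrow> (f x, f y) \<in> RB"
    using assms(1) unfolding poset_iso_def by blast
  obtain g where g: "bij_betw g B C" "\<forall>x\<in>B. \<forall>y\<in>B. (x, y) \<in> RB \<longleftrightarrow> (g x, g y) \<in> RC"
    using assms(2) unfolding poset_iso_def by blast
  have "bij_betw (g \<circ> f) A C"
    using f(1) g(1) by (rule bij_betw_trans)
  moreover have "\<forall>x\<in>A. \<forall>y\<in>A. (x, y) \<in> RA \<longleftrightarrow> ((g \<circ> f) x, (g \<circ> f) y) \<in> RC"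
    using f g by (auto simp: bij_betw_def)
  ultimately show ?thesis
    unfolding poset_iso_def by blast
qed

locale gamma_witness =
  fixes S :: "'a set" and R :: "'a rel" and n k :: nat
    and Pc :: "nat \<Rightarrow> 'b set" and Pr :: "nat \<Rightarrow> 'b rel"
  assumes Gamma: "Gamma n k Pc Pr" and witness: "witness S R n k Pc Pr"
begin

(* Meaningful only on vertices of G_n(Q): there the witness property makes the class exist and
   Gamma makes it unique. *)
definition iso_class :: "'a set \<Rightarrow> nat" where
  "iso_class D = (SOME i. i \<in> {1..k} \<and> poset_iso D R (Pc i) (Pr i))"

lemma iso_class_someI:
  assumes "i \<in> {1..k}" "poset_iso D R (Pc i) (Pr i)"
  shows "iso_class D \<in> {1..k}" "poset_iso D R (Pc (iso_class D)) (Pr (iso_class D))"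
  using someI[of "\<lambda>i. i \<in> {1..k} \<and> poset_iso D R (Pc i) (Pr i)"] assms
  unfolding iso_class_def by blast+

lemma iso_class:
  assumes "exch_vertex S R n D"
  shows "iso_class D \<in> {1..k}" "poset_iso D R (Pc (iso_class D)) (Pr (iso_class D))"
  using witness assms iso_class_someI unfolding witness_def exch_vertex_def by blast+

lemma iso_class_eq:
  assumes "i \<in> {1..k}" "poset_iso D R (Pc i) (Pr i)"
  shows "iso_class D = i"
proof -
  have "poset_iso (Pc (iso_class D)) (Pr (iso_class D)) (Pc i) (Pr i)"
    using poset_iso_trans[OF poset_iso_sym[OF iso_class_someI(2)[OF assms]] assms(2)] .
  then show ?thesis
    using Gamma iso_class_someI(1) assms unfolding Gamma_def by blast
qed

lemma special_path_iff_coloured: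
  "special_path S R n k Pc Pr v r \<longleftrightarrow> coloured_special_path (exch_vertex S R n) exch_edge iso_class v r"
proof
  assume "special_path S R n k Pc Pr v r"
  then obtain a b c where abc: "special_path_idx S R n k Pc Pr v r a b c"
    unfolding special_path_def by blast
  then have "iso_class (v 0) = a" "iso_class (v r) = c" "\<forall>t\<in>{0<..<r}. iso_class (v t) = b"
    unfolding special_path_idx_def by (auto intro!: iso_class_eq)
  with abc show "coloured_special_path (exch_vertex S R n) exch_edge iso_class v r"
    unfolding special_path_idx_def coloured_special_path_def special_segment_def exch_path_walk
    by (auto intro!: exI[of _ b])
next
  assume "coloured_special_path (exch_vertex S R n) exch_edge iso_class v r"
  then obtain b where path: "walk (exch_vertex S R n) exch_edge v r" "inj_on v {0..r}" "2 \<le> r"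
    "iso_class (v 0) \<noteq> iso_class (v r)" "b \<noteq> iso_class (v 0)" "b \<noteq> iso_class (v r)"
    and interior: "\<And>t. 0 < t \<Longrightarrow> t < r \<Longrightarrow> iso_class (v t) = b"
    by (elim coloured_special_pathE) blast
  note vertex = walk_vertex[OF path(1)]
  have "b \<in> {1..k}"
    using iso_class(1)[OF vertex[of 1]] interior[of 1] path(3) by simp
  moreover have "poset_iso (v j) R (Pc b) (Pr b)" if "j \<in> {1..r - 1}" for j
  proof -
    have "0 < j" "j < r"
      using that path(3) by auto
    then show ?thesis
      using iso_class(2)[OF vertex[of j]] interior[of j] by simp
  qed
  ultimately have "special_path_idx S R n k Pc Pr v r (iso_class (v 0)) b (iso_class (v r))"
    using path iso_class[OF vertex] unfolding special_path_idx_def exch_path_walk by auto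
  then show "special_path S R n k Pc Pr v r"
    unfolding special_path_def by blast
qed

lemma order_trans_antisym: "trans R" "antisym R"
  using witness unfolding witness_def by (auto dest: partial_order_onD)

lemma special_path_within_distance:
  assumes "special_path S R n k Pc Pr v r"
  shows "\<exists>u L. special_path S R n k Pc Pr u L \<and> L \<le> max 2 (card (v 0 - v r))"
proof -
  have path: "coloured_special_path (exch_vertex S R n) exch_edge iso_class v r"
    using assms unfolding special_path_iff_coloured .
  then have "walk (exch_vertex S R n) exch_edge v r"
    unfolding coloured_special_path_def by blast
  then obtain g where "walk (exch_vertex S R n) exch_edge g (card (v 0 - v r))"
    "g 0 = v 0" "g (card (v 0 - v r)) = v r"
    using exch_vertex_walk[OF order_trans_antisym] walk_vertex by blast
  from coloured_special_path_detour[OF path this] show ?thesis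
    unfolding special_path_iff_coloured using exch_edge_sym by blast
qed

end

theorem mainTheorem13:
  fixes S :: "'a set" and R :: "'a rel" and n k :: nat
    and Pc :: "nat \<Rightarrow> 'b set" and Pr :: "nat \<Rightarrow> 'b rel"
    and v :: "nat \<Rightarrow> 'a set" and r :: nat
  assumes "k \<ge> 3"
    and "Gamma n k Pc Pr"
    and "witness S R n k Pc Pr"
    and "special_path S R n k Pc Pr v r"
    and "\<forall>v' r'. special_path S R n k Pc Pr v' r' \<longrightarrow> r \<le> r'"
    and "r \<ge> 3"
  shows "(\<Union>j\<in>{0..r}. v j) = v 0 \<union> v r \<and>
         r - 1 = card (v 0 - (v 0 \<inter> v r)) - 1 \<and>
         r - 1 = card (v r - (v 0 \<inter> v r)) - 1"
proof -
  interpret gamma_witness S R n k Pc Pr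
    using assms(2,3) by unfold_locales
  have walk: "walk (exch_vertex S R n) exch_edge v r"
    using assms(4) unfolding special_path_iff_coloured coloured_special_path_def by blast
  then have finite_walk: "walk finite exch_edge v r"
    by (rule walk_mono) (simp add: exch_vertex_def)
  obtain u L where "special_path S R n k Pc Pr u L" "L \<le> max 2 (card (v 0 - v r))"
    using special_path_within_distance[OF assms(4)] by blast
  then have "r \<le> card (v 0 - v r)"
    using assms(5,6) by fastforce
  moreover have "card (v 0 - v r) \<le> r"
    using walk_card_Diff_le[OF finite_walk, of 0 r "v r"] by simp
  ultimately have distance: "card (v 0 - v r) = r"
    by simp
  moreover have "card (v r - v 0) = card (v 0 - v r)"
    using walk_vertex[OF walk, of 0] walk_vertex[OF walk, of r] unfolding exch_vertex_def
    by (simp add: card_Diff_subset_Int Int_commute)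
  moreover have "(\<Union>j\<in>{0..r}. v j) = v 0 \<union> v r"
    using geodesic_walk_subset_Un[OF finite_walk distance] by fastforce
  ultimately show ?thesis
    by (simp add: Diff_Int)
qed

end
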